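(* Let $\alpha\in(0,1)$ and $R>0$ be two real numbers. For any Borel probability measure $\mu$ on $\mathbb{R}$, there exists a 1-Lipschitz function $f\colon\mathbb{R}\to[-R/\alpha,R/\alpha]$ such that $$\operatorname{PartDiam}(f_*\mu;\alpha)=\min\{R,\operatorname{PartDiam}(\mu;\alpha)\}.$$
   Context: For a Borel probability measure $\mu$ on a metric space $Y$ and a real number $\alpha\le 1$, the partial diameter $\operatorname{PartDiam}(\mu;\alpha)$ is the infimum of the diameters of all Borel subsets $A\subset Y$ with $\mu(A)\ge\alpha$. $f_*\mu$ denotes the push-forward of $\mu$ by $f$. A function $f$ is 1-Lipschitz if $|f(x)-f(y)|\le|x-y|$ for all $x,y$. *)

theory Defs
  imports "HOL-Probability.Probability"
begin

text \<open>The library constant \<^const>\<open>diameter\<close> is real-valued and only meaningful for bounded sets,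
  so an unbounded set is given diameter \<open>\<infinity>\<close> here.\<close>

definition ext_diameter :: "'a::metric_space set \<Rightarrow> ennreal" where
  "ext_diameter A = (if bounded A then ennreal (diameter A) else \<infinity>)"

text \<open>Intended for Borel probability measures, that is \<open>sets \<mu> = sets borel\<close>. The infimum of an
  empty family (possible only for \<open>\<alpha> > 1\<close>) is \<open>\<infinity>\<close>.\<close>

definition part_diam :: "'a::metric_space measure \<Rightarrow> real \<Rightarrow> ennreal" where
  "part_diam \<mu> \<alpha> = (INF A\<in>{A \<in> sets \<mu>. measure \<mu> A \<ge> \<alpha>}. ext_diameter A)"

end

theory Submission
  imports Defs
begin

text \<open>
  A Lipschitz map with constant at most \<open>1\<close> cannot increase the partial diameter, and multiplying
  a function by \<open>c > 0\<close> multiplies the partial diameter of the push-forward by \<open>c\<close>. With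
  \<open>m = min R (part_diam \<mu> \<alpha>)\<close>, it is therefore enough to find a \<open>1\<close>-Lipschitz
  \<open>f\<close> with values in \<open>[-m/\<alpha>, m/\<alpha>]\<close> whose push-forward has partial diameter
  \<^emph>\<open>at least\<close> \<open>m\<close>; a factor \<open>c \<le> 1\<close> then gives equality. For \<open>m = 0\<close> a constant will do; in the rest of this
  explanation \<open>R\<close> stands for that \<open>m > 0\<close>. Call an interval heavy if its mass is at least
  \<open>\<alpha>\<close>; since \<open>R\<close> is at most the partial diameter of \<open>\<mu>\<close>, every heavy
  interval has length at least \<open>R\<close>.

  The function is chosen nondecreasing, \<open>1\<close>-Lipschitz, and such that \<open>f x + R \<le> f y\<close>
  whenever \<open>[x, y]\<close> is heavy. These are difference constraints, so their least nonnegative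
  solution is a longest path: \<open>f z\<close> is the largest gain of a walk that ends at \<open>z\<close>, where
  a walk gains \<open>R\<close> by jumping across a heavy interval from left to right, pays the distance for
  moving to the left, and moves to the right for free. The only question is why \<open>f\<close> is bounded by
  \<open>2R/\<alpha>\<close>. If a jump starts at or before the end of the jump before the previous one, then
  omitting the previous jump does not decrease the gain: it gives up \<open>R\<close>, but it saves at least
  the length of that jump on the way back, and the length is at least \<open>R\<close>. So only reduced walks matter, in
  which every point lies in at most two of the heavy intervals used. If \<open>k\<close> intervals are used,
  then \<open>k\<alpha> \<le> 2\<close>, and the gain is at most \<open>kR \<le> 2R/\<alpha>\<close>. The lemmas
  \<open>reduced_chain_append\<close> and \<open>reduced_chain_value_le\<close> are these two steps, and
  \<open>lipschitz_separating_heavy_intervals\<close> constructs \<open>f\<close>.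

  Separation at the ends of heavy intervals gives the bound for every Borel set \<open>A\<close> of
  push-forward mass at least \<open>\<alpha>\<close>, provided that the preimage of the closure of \<open>A\<close> has
  a least and a greatest element. For this reason \<open>\<mu>\<close> is first pushed to a compact interval
  \<open>[-N, N]\<close> by clamping; if \<open>N\<close> is large, heavy intervals are still of length at least
  \<open>R\<close>.
\<close>

section \<open>Partial diameter under Lipschitz maps\<close>

lemma diameter_lipschitz_image_le:
  fixes g :: "'a::metric_space \<Rightarrow> 'b::metric_space"
  assumes g: "C-lipschitz_on UNIV g" and A: "bounded A"
  shows "diameter (g ` A) \<le> C * diameter A"
proof (cases "A = {}")
  case True
  then show ?thesis by simp
next
  case False
  have C: "0 \<le> C" using g by (rule lipschitz_on_nonneg)
  have bound: "dist (g x) (g y) \<le> C * diameter A" if xy: "x \<in> A" "y \<in> A" for x y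
  proof -
    have "dist (g x) (g y) \<le> C * dist x y"
      using lipschitz_onD[OF g] xy by simp
    also have "\<dots> \<le> C * diameter A"
      using diameter_bounded_bound[OF A xy] C by (rule mult_left_mono)
    finally show ?thesis .
  qed
  have "(SUP (u, v)\<in>g ` A \<times> g ` A. dist u v) \<le> C * diameter A"
    using False bound by (intro cSUP_least) auto
  then show ?thesis using False by (simp add: diameter_def)
qed

lemma ext_diameter_closure [simp]: "ext_diameter (closure A) = ext_diameter A"
  using bounded_subset[OF _ closure_subset, of A]
  by (auto simp: ext_diameter_def diameter_closure)

lemma ext_diameter_lipschitz_image_le:
  fixes g :: "'a::metric_space \<Rightarrow> 'b::metric_space"
  assumes g: "C-lipschitz_on UNIV g" and A: "bounded A"
  shows "ext_diameter (g ` A) \<le> ennreal C * ext_diameter A"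
proof -
  obtain a e where "\<forall>x\<in>A. dist a x \<le> e" using A by (auto simp: bounded_def)
  then have "\<forall>x\<in>A. dist (g a) (g x) \<le> C * e"
    using lipschitz_onD[OF g, of a] lipschitz_on_nonneg[OF g]
    by (meson UNIV_I mult_left_mono order_trans)
  then have "bounded (g ` A)" by (auto simp: bounded_def)
  moreover have "0 \<le> C" using g by (rule lipschitz_on_nonneg)
  ultimately show ?thesis
    using diameter_lipschitz_image_le[OF g A] A
    by (simp add: ext_diameter_def ennreal_mult[symmetric] diameter_ge_0 ennreal_leI)
qed

text \<open>The image of a Borel set need not be Borel. Its closure is, and has the same diameter.\<close>

lemma part_diam_distr_lipschitz_le:
  fixes g :: "'a::metric_space \<Rightarrow> 'b::metric_space"
  assumes g: "C-lipschitz_on UNIV g" and C: "0 < C"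
    and \<nu>: "finite_measure \<nu>" "sets \<nu> = sets borel"
  shows "part_diam (distr \<nu> borel g) \<alpha> \<le> ennreal C * part_diam \<nu> \<alpha>"
proof -
  interpret finite_measure \<nu> by fact
  have "continuous_on UNIV g" using g by (rule lipschitz_on_continuous_on)
  then have g_meas: "g \<in> measurable \<nu> borel"
    using \<nu>(2) borel_measurable_continuous_onI measurable_cong_sets by blast
  have space: "space \<nu> = UNIV" using sets_eq_imp_space_eq[OF \<nu>(2)] by simp
  have "part_diam (distr \<nu> borel g) \<alpha> / ennreal C \<le> ext_diameter A"
    if A: "A \<in> sets \<nu>" "\<alpha> \<le> measure \<nu> A" for A
  proof (cases "bounded A")
    case True
    have "measure \<nu> A \<le> measure \<nu> (g -` closure (g ` A) \<inter> space \<nu>)"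
    proof (rule finite_measure_mono)
      show "A \<subseteq> g -` closure (g ` A) \<inter> space \<nu>" using space by (auto intro: closure_subset[THEN subsetD])
      show "g -` closure (g ` A) \<inter> space \<nu> \<in> sets \<nu>"
        using g_meas by (rule measurable_sets) simp
    qed
    also have "\<dots> = measure (distr \<nu> borel g) (closure (g ` A))"
      using g_meas by (simp add: measure_distr)
    finally have "\<alpha> \<le> measure (distr \<nu> borel g) (closure (g ` A))" using A by simp
    then have "part_diam (distr \<nu> borel g) \<alpha> \<le> ext_diameter (closure (g ` A))"
      unfolding part_diam_def by (intro INF_lower) auto
    also have "\<dots> \<le> ennreal C * ext_diameter A"
      using ext_diameter_lipschitz_image_le[OF g True] by simp
    finally show ?thesis
      using C by (subst divide_le_posI_ennreal) (auto simp: mult.commute)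
  next
    case False
    then show ?thesis by (simp add: ext_diameter_def)
  qed
  then have "part_diam (distr \<nu> borel g) \<alpha> / ennreal C \<le> part_diam \<nu> \<alpha>"
    unfolding part_diam_def[of \<nu>] by (intro INF_greatest) auto
  then have "ennreal C * (part_diam (distr \<nu> borel g) \<alpha> / ennreal C) \<le> ennreal C * part_diam \<nu> \<alpha>"
    by (rule mult_left_mono) simp
  also have "ennreal C * (part_diam (distr \<nu> borel g) \<alpha> / ennreal C) = part_diam (distr \<nu> borel g) \<alpha>"
    using C ennreal_mult_divide_eq[of "ennreal C" "part_diam (distr \<nu> borel g) \<alpha>"]
    by (simp add: ennreal_times_divide mult.commute[of "ennreal C"])
  finally show ?thesis .
qed

section \<open>Chains of long intervals\<close>

text \<open>
  \<open>J x y\<close> says that a walk may jump from \<open>x\<close> to \<open>y\<close>, gaining \<open>R\<close>. In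
  \<open>reduced_chain J R q y v\<close> the walk has just jumped to \<open>y\<close>, its total gain is \<open>v\<close>,
  and \<open>q\<close> is where the preceding jump ended. The side condition \<open>q < x'\<close> makes the next
  jump disjoint from the one before the last. After the first jump there is no preceding one; its
  starting point serves as \<open>q\<close>, because a second jump from a point not beyond it gains nothing
  over making that second jump alone, provided that jumps have length at least \<open>R\<close>.
\<close>

inductive reduced_chain :: "(real \<Rightarrow> real \<Rightarrow> bool) \<Rightarrow> real \<Rightarrow> real \<Rightarrow> real \<Rightarrow> real \<Rightarrow> bool"
  for J :: "real \<Rightarrow> real \<Rightarrow> bool" and R :: real
where
  single: "J x y \<Longrightarrow> reduced_chain J R x y R"
| extend: "reduced_chain J R q y v \<Longrightarrow> q < x' \<Longrightarrow> J x' y' \<Longrightarrow>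
    reduced_chain J R y y' (v - max 0 (y - x') + R)"

text \<open>
  Any jump can be appended to a reduced chain if earlier jumps may be dropped. If the new jump
  starts at \<open>x' \<le> q\<close>, the last jump, from \<open>x1\<close> to \<open>y1\<close>, can be removed without
  loss: its gain \<open>R \<le> y1 - x1\<close> is at most what is saved by going back directly from \<open>q\<close>
  to \<open>x'\<close>. Removing it exposes the shorter chain, to which the induction hypothesis applies.
\<close>

lemma reduced_chain_append:
  assumes long: "\<And>x y. J x y \<Longrightarrow> R \<le> y - x"
    and "reduced_chain J R q y v" and "J x' y'"
  shows "\<exists>q' v'. reduced_chain J R q' y' v' \<and> v - max 0 (y - x') + R \<le> v'"
  using assms(2,3)
proof (induction arbitrary: x' y')
  case (single x y)
  show ?case
  proof (cases "x < x'")
    case True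
    then show ?thesis
      using reduced_chain.extend[of J, OF reduced_chain.single[of J, OF single(1)] True single(2)] by blast
  next
    case False
    have "R \<le> y - x'" using long[OF single(1)] False by simp
    then show ?thesis
      using reduced_chain.single[of J, OF single(2), of R] by (intro exI[of _ x'] exI[of _ R]) auto
  qed
next
  case (extend q y v x1 y1)
  show ?case
  proof (cases "y < x'")
    case True
    then show ?thesis
      using reduced_chain.extend[of J, OF reduced_chain.extend[of J, OF extend.hyps] True extend.prems] by blast
  next
    case False
    obtain q' v' where *: "reduced_chain J R q' y' v'" "v - max 0 (y - x') + R \<le> v'"
      using extend.IH[OF extend.prems] by blast
    have "v - max 0 (y - x1) + R - max 0 (y1 - x') \<le> v - max 0 (y - x')"
      using long[OF extend.hyps(3)] False by linarith
    then show ?thesis using * by (intro exI[of _ q'] exI[of _ v']) auto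
  qed
qed

text \<open>
  The first, third, fifth and further odd-numbered intervals of a reduced chain are pairwise disjoint, and so are the
  others. The two subsequences lie to the left of \<open>q\<close> and of \<open>y\<close> respectively (or vice
  versa), which bounds \<open>\<alpha>\<close> times the number of intervals by the sum of the two masses. Stating
  the bound with these masses rather than with \<open>2\<close> is what makes the induction work.
\<close>

lemma reduced_chain_value_le:
  fixes \<nu> :: "real measure"
  assumes \<nu>: "finite_measure \<nu>" "sets \<nu> = sets borel" and "0 < \<alpha>" "0 < R"
    and "reduced_chain (\<lambda>x y. \<alpha> \<le> measure \<nu> {x..y}) R q y v"
  shows "v \<le> R / \<alpha> * (measure \<nu> {..q} + measure \<nu> {..y})"
  using assms(5)
proof induction
  interpret finite_measure \<nu> by fact
  case (single x y)
  have "\<alpha> \<le> measure \<nu> {..y}"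
    using single by (rule order_trans) (intro finite_measure_mono, auto simp: \<nu>)
  then have "R / \<alpha> * \<alpha> \<le> R / \<alpha> * (measure \<nu> {..x} + measure \<nu> {..y})"
    using assms(3,4) by (intro mult_left_mono) (auto intro: add_increasing)
  then show ?case using assms(3) by simp
next
  interpret finite_measure \<nu> by fact
  case (extend q y v x' y')
  have "measure \<nu> {..q} + measure \<nu> {x'..y'} = measure \<nu> ({..q} \<union> {x'..y'})"
    using extend.hyps by (intro finite_measure_Union[symmetric]) (auto simp: \<nu>)
  also have "\<dots> \<le> measure \<nu> {..y'}"
  proof (intro finite_measure_mono)
    have "{x'..y'} \<noteq> {}" using extend.hyps(3) assms(3) by force
    then show "{..q} \<union> {x'..y'} \<subseteq> {..y'}" using extend.hyps(2) by auto
  qed (auto simp: \<nu>)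
  finally have "measure \<nu> {..q} + \<alpha> \<le> measure \<nu> {..y'}" using extend.hyps(3) by linarith
  then have "R / \<alpha> * (measure \<nu> {..q} + measure \<nu> {..y} + \<alpha>)
      \<le> R / \<alpha> * (measure \<nu> {..y} + measure \<nu> {..y'})"
    using assms(3,4) by (intro mult_left_mono) auto
  moreover have "R / \<alpha> * (measure \<nu> {..q} + measure \<nu> {..y} + \<alpha>)
      = R / \<alpha> * (measure \<nu> {..q} + measure \<nu> {..y}) + R"
    using assms(3) by (simp add: field_simps)
  ultimately show ?case using extend.IH by linarith
qed

text \<open>
  The longest-path function, shifted by \<open>R/\<alpha>\<close> to centre its range. The value \<open>0\<close> of
  the empty walk is always available. Jumps give the separation; moving from \<open>z\<close> to
  \<open>z'\<close> at the end of a walk gives monotonicity and the Lipschitz bound.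
\<close>

lemma lipschitz_separating_heavy_intervals:
  fixes \<nu> :: "real measure"
  assumes \<nu>: "prob_space \<nu>" "sets \<nu> = sets borel" and pos: "0 < \<alpha>" "0 < R"
    and long: "\<And>x y. \<alpha> \<le> measure \<nu> {x..y} \<Longrightarrow> R \<le> y - x"
  obtains f :: "real \<Rightarrow> real" where "1-lipschitz_on UNIV f" "f ` UNIV \<subseteq> {- R / \<alpha> .. R / \<alpha>}"
    "\<And>x y. \<alpha> \<le> measure \<nu> {x..y} \<Longrightarrow> f x + R \<le> f y"
proof -
  interpret prob_space \<nu> by fact
  let ?J = "\<lambda>x y. \<alpha> \<le> measure \<nu> {x..y}"
  define S where "S z = insert 0 {v - max 0 (y - z) | q y v. reduced_chain ?J R q y v}" for z
  define f where "f z = Sup (S z)" for z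
  have S_le: "s \<le> 2 * R / \<alpha>" if s: "s \<in> S z" for s z
  proof -
    have "v \<le> 2 * R / \<alpha>" if "reduced_chain ?J R q y v" for q y v
    proof -
      have "v \<le> R / \<alpha> * (measure \<nu> {..q} + measure \<nu> {..y})"
        using finite_measure_axioms \<nu>(2) pos that by (rule reduced_chain_value_le)
      also have "\<dots> \<le> R / \<alpha> * (1 + 1)"
        using pos by (intro mult_left_mono add_mono) auto
      finally show ?thesis by (simp add: mult.commute[of 2])
    qed
    moreover have "0 \<le> 2 * R / \<alpha>" using pos by simp
    ultimately show ?thesis using s unfolding S_def by fastforce
  qed
  then have bdd: "bdd_above (S z)" for z by (meson bdd_above.I)
  have S_nonempty: "S z \<noteq> {}" for z by (simp add: S_def)
  have f_ge: "s \<le> f z" if "s \<in> S z" for s z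
    unfolding f_def using that bdd by (rule cSup_upper)
  have f_le: "f z \<le> b" if "\<And>s. s \<in> S z \<Longrightarrow> s \<le> b" for z b
    unfolding f_def using S_nonempty that by (rule cSup_least)
  have f_move: "f z \<le> f z' + max 0 (z - z')" for z z'
  proof (rule f_le)
    fix s assume "s \<in> S z"
    then consider "s = 0" | q y v where "reduced_chain ?J R q y v" "s = v - max 0 (y - z)"
      unfolding S_def by blast
    then show "s \<le> f z' + max 0 (z - z')"
    proof cases
      case 1
      then show ?thesis using f_ge[of 0 z'] by (simp add: S_def)
    next
      case 2
      then have "v - max 0 (y - z') \<in> S z'" unfolding S_def by blast
      from f_ge[OF this] show ?thesis using 2(2) by linarith
    qed
  qed
  have f_jump: "f x + R \<le> f y" if heavy: "?J x y" for x y
  proof -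
    have "f x \<le> f y - R"
    proof (rule f_le)
      fix s assume "s \<in> S x"
      then consider "s = 0" | q' y' v where "reduced_chain ?J R q' y' v" "s = v - max 0 (y' - x)"
        unfolding S_def by blast
      then have "\<exists>q v. reduced_chain ?J R q y v \<and> s + R \<le> v"
      proof cases
        case 1
        then show ?thesis using reduced_chain.single[of ?J, OF heavy] by force
      next
        case 2
        then show ?thesis using reduced_chain_append[of ?J, OF long 2(1) heavy] by simp
      qed
      then obtain q v where qv: "reduced_chain ?J R q y v" "s + R \<le> v" by blast
      then have "v - max 0 (y - y) \<in> S y" unfolding S_def by blast
      from f_ge[OF this] show "s \<le> f y - R" using qv(2) by simp
    qed
    then show ?thesis by simp
  qed
  show ?thesis
  proof (rule that[of "\<lambda>z. f z - R / \<alpha>"])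
    show "1-lipschitz_on UNIV (\<lambda>z. f z - R / \<alpha>)"
    proof (rule lipschitz_onI)
      fix x y :: real
      show "dist (f x - R / \<alpha>) (f y - R / \<alpha>) \<le> 1 * dist x y"
        using f_move[of x y] f_move[of y x] by (simp add: dist_real_def)
    qed simp
    have "0 \<le> f z" "f z \<le> 2 * R / \<alpha>" for z
      using f_ge[of 0 z] f_le[OF S_le] by (auto simp: S_def)
    then show "(\<lambda>z. f z - R / \<alpha>) ` UNIV \<subseteq> {- R / \<alpha> .. R / \<alpha>}"
      by (auto simp: field_simps)
    show "f x - R / \<alpha> + R \<le> f y - R / \<alpha>" if "?J x y" for x y
      using f_jump[OF that] by simp
  qed
qed

section \<open>Passing from heavy intervals to arbitrary heavy sets\<close>

text \<open>
  A preimage of mass at least \<open>\<alpha>\<close> that is compact spans an interval whose two ends belong to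
  it. That interval is heavy, so the values of \<open>f\<close> at its ends are at distance at least
  \<open>R\<close>. Without compactness this fails: a half-line may have mass \<open>\<alpha>\<close> while all of its
  bounded subintervals have less.
\<close>

lemma part_diam_distr_ge:
  fixes \<nu> :: "real measure" and f :: "real \<Rightarrow> real"
  assumes \<nu>: "prob_space \<nu>" "sets \<nu> = sets borel" and "0 < \<alpha>"
    and supp: "measure \<nu> {-N..N} = 1"
    and f: "continuous_on UNIV f" and sep: "\<And>x y. \<alpha> \<le> measure \<nu> {x..y} \<Longrightarrow> f x + R \<le> f y"
  shows "ennreal R \<le> part_diam (distr \<nu> borel f) \<alpha>"
  unfolding part_diam_def
proof (rule INF_greatest, clarify)
  interpret prob_space \<nu> by fact
  have f_meas: "f \<in> measurable \<nu> borel"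
    using \<nu>(2) f borel_measurable_continuous_onI measurable_cong_sets by blast
  have space: "space \<nu> = UNIV" using sets_eq_imp_space_eq[OF \<nu>(2)] by simp
  fix A assume A: "A \<in> sets (distr \<nu> borel f)" "\<alpha> \<le> measure (distr \<nu> borel f) A"
  show "ennreal R \<le> ext_diameter A"
  proof (cases "bounded A")
    case True
    define B where "B = f -` closure A \<inter> {-N..N}"
    have "closed (f -` closure A)" using f by (simp add: closed_vimage)
    then have "compact B" unfolding B_def by (simp add: closed_Int_compact)
    have B_sets: "B \<in> sets \<nu>"
      using compact_imp_closed[OF \<open>compact B\<close>] \<nu>(2) by simp
    have "AE x in \<nu>. x \<in> {-N..N}" using supp \<nu>(2) by (subst (asm) prob_eq_1) auto
    have "measure (distr \<nu> borel f) A = measure \<nu> (f -` A \<inter> space \<nu>)"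
      using f_meas A by (intro measure_distr) auto
    also have "\<dots> \<le> measure \<nu> B"
    proof (rule finite_measure_mono_AE)
      show "AE x in \<nu>. x \<in> f -` A \<inter> space \<nu> \<longrightarrow> x \<in> B"
        using \<open>AE x in \<nu>. x \<in> {-N..N}\<close> unfolding B_def
        by eventually_elim (auto intro: closure_subset[THEN subsetD])
    qed fact
    finally have B_heavy: "\<alpha> \<le> measure \<nu> B" using A(2) by simp
    then have "B \<noteq> {}" using assms(3) by auto
    obtain x y where xy: "x \<in> B" "y \<in> B" "B \<subseteq> {x..y}"
      using compact_attains_inf[OF \<open>compact B\<close> \<open>B \<noteq> {}\<close>]
        compact_attains_sup[OF \<open>compact B\<close> \<open>B \<noteq> {}\<close>] by (auto simp: subset_eq)
    have "measure \<nu> B \<le> measure \<nu> {x..y}"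
      using xy(3) \<nu>(2) by (intro finite_measure_mono) auto
    then have "f x + R \<le> f y" using B_heavy by (intro sep) simp
    then have "R \<le> dist (f x) (f y)" by (simp add: dist_real_def)
    also have "\<dots> \<le> diameter (closure A)"
      using xy True by (intro diameter_bounded_bound) (auto simp: B_def)
    finally show ?thesis
      using True by (simp add: ext_diameter_def diameter_closure ennreal_leI)
  qed (simp add: ext_diameter_def)
qed

text \<open>
  Clamping changes the mass of \<open>[x, y]\<close> only if the interval reaches \<open>N\<close> or \<open>-N\<close>. If
  it is shorter than \<open>R\<close>, all of its mass then comes from outside \<open>(R - N, N - R)\<close>, so
  \<open>N\<close> is chosen to leave mass less than \<open>\<alpha>\<close> there.
\<close>

lemma clamp_keeps_heavy_intervals_long:
  fixes \<mu> :: "real measure"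
  assumes \<mu>: "prob_space \<mu>" "sets \<mu> = sets borel" and pos: "0 < \<alpha>" "0 < R"
    and long: "\<And>x y. \<alpha> \<le> measure \<mu> {x..y} \<Longrightarrow> R \<le> y - x"
  obtains N where "0 \<le> N" "\<And>x y. \<alpha> \<le> measure (distr \<mu> borel (\<lambda>x. max (-N) (min N x))) {x..y} \<Longrightarrow> R \<le> y - x"
proof -
  interpret prob_space \<mu> by fact
  have space: "space \<mu> = UNIV" using sets_eq_imp_space_eq[OF \<mu>(2)] by simp
  define T where "T n = {x::real. real n \<le> \<bar>x\<bar>}" for n
  have T_sets: "T n \<in> sets \<mu>" for n unfolding T_def \<mu>(2) by measurable
  have "(\<lambda>n. measure \<mu> (T n)) \<longlonglongrightarrow> measure \<mu> (\<Inter>n. T n)"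
  proof (rule finite_Lim_measure_decseq)
    show "range T \<subseteq> sets \<mu>" using T_sets by auto
    show "decseq T" unfolding T_def decseq_def by fastforce
  qed
  moreover have "(\<Inter>n. T n) = {}"
    unfolding T_def using reals_Archimedean2 by (fastforce simp: not_le[symmetric])
  ultimately have "(\<lambda>n. measure \<mu> (T n)) \<longlonglongrightarrow> 0" by simp
  then have "\<forall>\<^sub>F n in sequentially. measure \<mu> (T n) < \<alpha>" using pos(1) by (rule order_tendstoD)
  then obtain n where n: "measure \<mu> (T n) < \<alpha>" by (meson eventually_happens' sequentially_bot)
  \<comment> \<open>The summand \<open>R\<close> keeps an interval shorter than \<open>R\<close> that reaches \<open>N\<close> or \<open>-N\<close>
    inside \<open>T n\<close>.\<close>
  define N where "N = real n + R"
  define \<kappa> where "\<kappa> x = max (-N) (min N x)" for x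
  have \<kappa>_meas: "\<kappa> \<in> measurable \<mu> borel"
    unfolding \<kappa>_def measurable_cong_sets[OF \<mu>(2) refl] by measurable
  have "R \<le> y - x" if heavy: "\<alpha> \<le> measure (distr \<mu> borel \<kappa>) {x..y}" for x y
  proof (rule ccontr)
    assume short: "\<not> R \<le> y - x"
    have eq: "measure (distr \<mu> borel \<kappa>) {x..y} = measure \<mu> (\<kappa> -` {x..y})"
      using \<kappa>_meas space by (simp add: measure_distr)
    have "\<kappa> -` {x..y} \<subseteq> {x..y} \<or> \<kappa> -` {x..y} \<subseteq> T n"
    proof (cases "- N < x \<and> y < N")
      case True
      then show ?thesis unfolding \<kappa>_def by (auto simp: max_def min_def split: if_splits)
    next
      case False
      have "real n \<le> \<bar>t\<bar>" if "t \<in> \<kappa> -` {x..y}" for t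
        using that False short pos(2) unfolding \<kappa>_def N_def by (auto simp: max_def min_def split: if_splits)
      then show ?thesis unfolding T_def by auto
    qed
    then have "measure \<mu> (\<kappa> -` {x..y}) \<le> measure \<mu> {x..y} \<or> measure \<mu> (\<kappa> -` {x..y}) \<le> measure \<mu> (T n)"
      using T_sets \<mu>(2) by (auto intro: finite_measure_mono)
    then show False using heavy eq n long[of x y] short by linarith
  qed
  moreover have "0 \<le> N" using pos(2) unfolding N_def by simp
  ultimately show ?thesis using that[of N] unfolding \<kappa>_def by blast
qed

lemma lipschitz_with_large_part_diam:
  fixes \<mu> :: "real measure"
  assumes \<mu>: "prob_space \<mu>" "sets \<mu> = sets borel" and pos: "0 < \<alpha>" "0 < R"
    and R: "ennreal R \<le> part_diam \<mu> \<alpha>"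
  obtains f :: "real \<Rightarrow> real" where "1-lipschitz_on UNIV f" "f ` UNIV \<subseteq> {- R / \<alpha> .. R / \<alpha>}"
    "ennreal R \<le> part_diam (distr \<mu> borel f) \<alpha>"
proof -
  interpret prob_space \<mu> by fact
  have space: "space \<mu> = UNIV" using sets_eq_imp_space_eq[OF \<mu>(2)] by simp
  have long: "R \<le> y - x" if heavy: "\<alpha> \<le> measure \<mu> {x..y}" for x y
  proof -
    have "x \<le> y" using heavy pos(1) by (rule_tac ccontr) simp
    have "ennreal R \<le> ext_diameter {x..y}"
      using R heavy \<mu>(2) unfolding part_diam_def
      by (elim order_trans) (intro INF_lower, auto)
    then show ?thesis using \<open>x \<le> y\<close> pos(2) by (simp add: ext_diameter_def)
  qed
  obtain N where "0 \<le> N" and N: "\<And>x y. \<alpha> \<le> measure (distr \<mu> borel (\<lambda>x. max (-N) (min N x))) {x..y} \<Longrightarrow> R \<le> y - x"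
    using clamp_keeps_heavy_intervals_long[OF \<mu> pos long] by blast
  define \<kappa> where "\<kappa> x = max (-N) (min N x)" for x
  define \<nu> where "\<nu> = distr \<mu> borel \<kappa>"
  have \<kappa>_meas: "\<kappa> \<in> measurable \<mu> borel"
    unfolding \<kappa>_def measurable_cong_sets[OF \<mu>(2) refl] by measurable
  have \<nu>: "prob_space \<nu>" "sets \<nu> = sets borel"
    unfolding \<nu>_def using \<kappa>_meas by (auto intro: prob_space_distr)
  have long': "R \<le> y - x" if "\<alpha> \<le> measure \<nu> {x..y}" for x y
    using N that unfolding \<nu>_def \<kappa>_def by blast
  obtain g where g: "1-lipschitz_on UNIV g" "g ` UNIV \<subseteq> {- R / \<alpha> .. R / \<alpha>}"
    "\<And>x y. \<alpha> \<le> measure \<nu> {x..y} \<Longrightarrow> g x + R \<le> g y"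
    using lipschitz_separating_heavy_intervals[OF \<nu> pos long'] by blast
  have g_cont: "continuous_on UNIV g" using g(1) by (rule lipschitz_on_continuous_on)
  show ?thesis
  proof (rule that[of "g \<circ> \<kappa>"])
    have "1-lipschitz_on UNIV \<kappa>"
      by (rule lipschitz_onI) (auto simp: \<kappa>_def dist_real_def)
    then have "(1 * 1)-lipschitz_on UNIV (g \<circ> \<kappa>)"
      using lipschitz_on_subset[OF g(1)] by (intro lipschitz_on_compose) auto
    then show "1-lipschitz_on UNIV (g \<circ> \<kappa>)" by simp
    show "(g \<circ> \<kappa>) ` UNIV \<subseteq> {- R / \<alpha> .. R / \<alpha>}" using g(2) by auto
    show "ennreal R \<le> part_diam (distr \<mu> borel (g \<circ> \<kappa>)) \<alpha>"
    proof -
      have "\<kappa> -` {-N..N} = UNIV" using \<open>0 \<le> N\<close> by (auto simp: \<kappa>_def)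
      then have "measure \<nu> {-N..N} = 1"
        unfolding \<nu>_def using \<kappa>_meas space prob_space by (simp add: measure_distr)
      then have "ennreal R \<le> part_diam (distr \<nu> borel g) \<alpha>"
        using part_diam_distr_ge[OF \<nu> pos(1) _ g_cont g(3)] by blast
      then show ?thesis
        unfolding \<nu>_def using \<kappa>_meas borel_measurable_continuous_onI[OF g_cont]
        by (simp add: distr_distr)
    qed
  qed
qed

section \<open>Scaling to the prescribed partial diameter\<close>

text \<open>The inequality for Lipschitz maps, used for the multiplications by \<open>c\<close> and by
  \<open>inverse c\<close>.\<close>

lemma part_diam_distr_scale:
  fixes f :: "'a::metric_space \<Rightarrow> real"
  assumes c: "0 < c" and \<mu>: "finite_measure \<mu>" "sets \<mu> = sets borel"
    and f: "f \<in> borel_measurable \<mu>"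
  shows "part_diam (distr \<mu> borel (\<lambda>x. c * f x)) \<alpha> = ennreal c * part_diam (distr \<mu> borel f) \<alpha>"
proof (rule antisym)
  interpret finite_measure \<mu> by fact
  have lip: "b-lipschitz_on UNIV ((*) b)" if "0 < b" for b :: real
    using that by (intro lipschitz_onI) (auto simp: dist_real_def abs_mult right_diff_distrib[symmetric])
  have upper: "part_diam (distr \<mu> borel (\<lambda>x. b * g x)) \<alpha> \<le> ennreal b * part_diam (distr \<mu> borel g) \<alpha>"
    if b: "0 < b" and g: "g \<in> borel_measurable \<mu>" for b :: real and g
  proof -
    have "distr \<mu> borel (\<lambda>x. b * g x) = distr (distr \<mu> borel g) borel ((*) b)"
      using g by (simp add: distr_distr comp_def)
    then show ?thesis
      using part_diam_distr_lipschitz_le[OF lip[OF b] b finite_measure_distr[OF g], of \<alpha>] by simp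
  qed
  show "part_diam (distr \<mu> borel (\<lambda>x. c * f x)) \<alpha> \<le> ennreal c * part_diam (distr \<mu> borel f) \<alpha>"
    using c f by (rule upper)
  have "part_diam (distr \<mu> borel f) \<alpha>
      \<le> ennreal (inverse c) * part_diam (distr \<mu> borel (\<lambda>x. c * f x)) \<alpha>"
    using upper[of "inverse c" "\<lambda>x. c * f x"] c f by (simp add: mult.assoc[symmetric])
  then have "ennreal c * part_diam (distr \<mu> borel f) \<alpha>
      \<le> ennreal c * (ennreal (inverse c) * part_diam (distr \<mu> borel (\<lambda>x. c * f x)) \<alpha>)"
    by (rule mult_left_mono) simp
  also have "\<dots> = part_diam (distr \<mu> borel (\<lambda>x. c * f x)) \<alpha>"
    using c by (simp add: mult.assoc[symmetric] ennreal_mult[symmetric])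
  finally show "ennreal c * part_diam (distr \<mu> borel f) \<alpha> \<le> part_diam (distr \<mu> borel (\<lambda>x. c * f x)) \<alpha>" .
qed

theorem theorem1p2:
  fixes \<alpha> R :: real and \<mu> :: "real measure"
  assumes "0 < \<alpha>" and "\<alpha> < 1" and "R > 0"
    and "prob_space \<mu>" and "sets \<mu> = sets borel"
  shows "\<exists>f :: real \<Rightarrow> real.
           1-lipschitz_on UNIV f \<and>
           f ` UNIV \<subseteq> {- R / \<alpha> .. R / \<alpha>} \<and>
           part_diam (distr \<mu> borel f) \<alpha> = min (ennreal R) (part_diam \<mu> \<alpha>)"
proof -
  interpret prob_space \<mu> by fact
  have space: "space \<mu> = UNIV" using sets_eq_imp_space_eq[OF assms(5)] by simp
  \<comment> \<open>A bounded \<open>f\<close> has finite partial diameter, because its range carries all of the mass.\<close>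
  have bounded_range: "part_diam (distr \<mu> borel f) \<alpha> \<le> ennreal (2 * b)"
    if f: "f \<in> borel_measurable \<mu>" "f ` UNIV \<subseteq> {-b..b}" for f and b :: real
  proof -
    have "f -` {-b..b} = UNIV" and "-b \<le> b" using f(2) by force+
    then have "measure (distr \<mu> borel f) {-b..b} = 1"
      using f(1) space prob_space by (simp add: measure_distr)
    then have "part_diam (distr \<mu> borel f) \<alpha> \<le> ext_diameter {-b..b}"
      unfolding part_diam_def using assms(2) by (intro INF_lower) auto
    then show ?thesis using \<open>-b \<le> b\<close> by (simp add: ext_diameter_def)
  qed
  obtain m where m: "0 \<le> m" "m \<le> R" "min (ennreal R) (part_diam \<mu> \<alpha>) = ennreal m"
  proof (cases "part_diam \<mu> \<alpha>")
    case (real r)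
    then show ?thesis using that[of "min R r"] assms(3) by (simp add: min_def ennreal_le_iff)
  next
    case top
    then show ?thesis using that[of R] assms(3) by simp
  qed
  show ?thesis
  proof (cases "m = 0")
    case True
    have "part_diam (distr \<mu> borel (\<lambda>x. 0 :: real)) \<alpha> = 0"
      using bounded_range[of "\<lambda>x. 0" 0] by simp
    then show ?thesis
      using True m assms(1,3) by (intro exI[of _ "\<lambda>x. 0"]) (auto intro: lipschitz_onI)
  next
    case False
    then have "0 < m" using m(1) by simp
    have "ennreal m \<le> part_diam \<mu> \<alpha>" using m(3) by (metis min.cobounded2)
    then obtain f where f: "1-lipschitz_on UNIV f" "f ` UNIV \<subseteq> {- m / \<alpha> .. m / \<alpha>}"
      "ennreal m \<le> part_diam (distr \<mu> borel f) \<alpha>"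
      using lipschitz_with_large_part_diam[OF assms(4,5,1) \<open>0 < m\<close>] by blast
    have f_meas: "f \<in> borel_measurable \<mu>"
      using borel_measurable_continuous_onI[OF lipschitz_on_continuous_on[OF f(1)]]
        measurable_cong_sets[OF assms(5) refl] by blast
    have "part_diam (distr \<mu> borel f) \<alpha> < top"
      using bounded_range[OF f_meas, of "m / \<alpha>"] f(2) ennreal_less_top
      by (auto intro: le_less_trans)
    then obtain p where p: "0 \<le> p" "part_diam (distr \<mu> borel f) \<alpha> = ennreal p"
      by (cases "part_diam (distr \<mu> borel f) \<alpha>") auto
    have "m \<le> p" using f(3) p by (simp add: ennreal_le_iff)
    define c where "c = m / p"
    have c: "0 < c" "c \<le> 1" "c * p = m" using \<open>0 < m\<close> \<open>m \<le> p\<close> by (auto simp: c_def)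
    have "part_diam (distr \<mu> borel (\<lambda>x. c * f x)) \<alpha> = ennreal m"
      using part_diam_distr_scale[OF c(1) finite_measure_axioms assms(5) f_meas, of \<alpha>] p c
      by (simp add: ennreal_mult[symmetric])
    moreover have "1-lipschitz_on UNIV (\<lambda>x. c * f x)"
    proof (rule lipschitz_onI)
      fix x y :: real
      have "dist (c * f x) (c * f y) = c * dist (f x) (f y)"
        using c(1) by (simp add: dist_real_def abs_mult right_diff_distrib[symmetric])
      also have "\<dots> \<le> 1 * dist (f x) (f y)" using c(2) by (rule mult_right_mono) simp
      also have "\<dots> \<le> 1 * dist x y" using lipschitz_onD[OF f(1), of x y] by simp
      finally show "dist (c * f x) (c * f y) \<le> 1 * dist x y" .
    qed simp
    moreover have "\<bar>c * f x\<bar> \<le> R / \<alpha>" for x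
    proof -
      have "\<bar>c * f x\<bar> \<le> 1 * \<bar>f x\<bar>"
        using c by (simp add: abs_mult mult_left_le_one_le)
      also have "\<dots> \<le> m / \<alpha>" using f(2) by (auto simp: abs_le_iff image_subset_iff minus_le_iff)
      also have "\<dots> \<le> R / \<alpha>" using m(2) assms(1) by (simp add: divide_right_mono)
      finally show ?thesis .
    qed
    then have "(\<lambda>x. c * f x) ` UNIV \<subseteq> {- R / \<alpha> .. R / \<alpha>}"
      by (auto simp: abs_le_iff minus_le_iff)
    ultimately show ?thesis using m(3) by (intro exI[of _ "\<lambda>x. c * f x"]) simp
  qed
qed

end
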